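(* Let $\bm{X}\in\mathbb{R}^{N\times D}$ have rows (patterns) $\bm{x}_1,\dots,\bm{x}_N\in\mathbb{R}^D$, let $\beta>0$, and let $\Omega$ be a generalized negentropy with domain $\triangle_N$ whose Fenchel-Young loss $L_\Omega$ has margin $m$. Let $E$ be the Hopfield-Fenchel-Young energy associated with $\bm{X},\beta,\Omega$, and consider the update rule $\bm{q}^{(t+1)}=\bm{X}^\top\hat{\bm{y}}_\Omega(\beta\bm{X}\bm{q}^{(t)})$. Let $\bm{x}_i$ be a pattern outside the convex hull of the other patterns, and let $\Delta_i=\bm{x}_i^\top\bm{x}_i-\max_{j\ne i}\bm{x}_i^\top\bm{x}_j$. (1) $\bm{x}_i$ is a stationary point of $E$ if and only if $\Delta_i\ge m\beta^{-1}$. (2) In addition, if the initial query $\bm{q}^{(0)}$ satisfies ${\bm{q}^{(0)}}^\top(\bm{x}_i-\bm{x}_j)\ge m\beta^{-1}$ for all $j\ne i$, then the update rule converges to $\bm{x}_i$ exactly in one iteration, i.e. $\bm{q}^{(t)}=\bm{x}_i$ for all $t\ge1$. (3) Moreover, if the patterns are normalized, $\|\bm{x}_k\|=M$ for all $k$, and well-separated with $\Delta_i\ge m\beta^{-1}+2M\epsilon$, then any $\bm{q}^{(0)}$ that is $\epsilon$-close to $\bm{x}_i$ (i.e. $\|\bm{q}^{(0)}-\bm{x}_i\|\le\epsilon$) will converge to $\bm{x}_i$ in one iteration, i.e. $\bm{q}^{(t)}=\bm{x}_i$ for all $t\ge1$.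
   Context: Notation: $\triangle_N=\{\bm{p}\in\mathbb{R}^N:\bm{p}\ge\mathbf{0},\ \mathbf{1}^\top\bm{p}=1\}$; $\bm{e}_i$ is the $i$-th standard basis vector; $\|\cdot\|$ is the Euclidean norm. Generalized negentropy: a function $\Omega:\mathbb{R}^N\to\mathbb{R}\cup\{+\infty\}$, finite exactly on $\triangle_N$, such that (i) $\Omega(\bm{e}_i)=0$ for all $i$; (ii) $\Omega$ is strictly convex on $\triangle_N$; (iii) $\Omega(\bm{P}\bm{y})=\Omega(\bm{y})$ for every permutation matrix $\bm{P}$. $\Omega^*(\bm{\theta})=\sup_{\bm{y}}\bm{\theta}^\top\bm{y}-\Omega(\bm{y})$; $\hat{\bm{y}}_\Omega(\bm{\theta})=\nabla\Omega^*(\bm{\theta})=\arg\max_{\bm{y}\in\triangle_N}\bm{\theta}^\top\bm{y}-\Omega(\bm{y})$ (the maximum is understood to be attained); Fenchel-Young loss $L_\Omega(\bm{\theta};\bm{y})=\Omega(\bm{y})+\Omega^*(\bm{\theta})-\bm{\theta}^\top\bm{y}$. Margin: a loss $L(\bm{\theta};\bm{y})$ has a margin if there is a finite $m\ge0$ such that for all $i\in\{1,\dots,N\}$ and all $\bm{\theta}\in\mathbb{R}^N$: $L(\bm{\theta};\bm{e}_i)=0\iff\theta_i-\max_{j\ne i}\theta_j\ge m$. The smallest such $m$ is the margin of $L$. (For $L_\Omega$, $L_\Omega(\bm{\theta};\bm{e}_i)=0$ is equivalent to $\hat{\bm{y}}_\Omega(\bm{\theta})=\bm{e}_i$.) Hopfield-Fenchel-Young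 energy: with $\bm{\mu}_{\bm{X}}=\bm{X}^\top\mathbf{1}/N$ and $M=\max_k\|\bm{x}_k\|$, $$E(\bm{q})=-\beta^{-1}L_\Omega(\beta\bm{X}\bm{q};\mathbf{1}/N)+\tfrac12\|\bm{q}-\bm{\mu}_{\bm{X}}\|^2+\tfrac12(M^2-\|\bm{\mu}_{\bm{X}}\|^2),\quad \bm{q}\in\mathbb{R}^D.$$ A stationary point of $E$ is a point where $\nabla E=\mathbf{0}$. Exact retrieval: a pattern $\bm{x}_i$ is exactly retrieved for query $\bm{q}^{(0)}$ iff there is a finite number of steps $T$ such that iterating the update rule leads to $\bm{q}^{(T')}=\bm{x}_i$ for all $T'\ge T$; exact convergence in one iteration is the case $T=1$.
   Formalization: In part (2), the condition on the initial query alone gives q^(1) = x_i; the claim q^(t) = x_i for all t ≥ 1 is stated under the additional condition Δ_i ≥ m/β, without which it is false. *)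

theory Defs
  imports "HOL-Analysis.Analysis"
begin

definition prob_simplex :: "(real ^ 'n) set" where
  "prob_simplex = {p. (\<forall>i. 0 \<le> p $ i) \<and> (\<Sum>i\<in>UNIV. p $ i) = 1}"

definition permutation_matrix :: "real ^ 'n ^ 'n \<Rightarrow> bool" where
  "permutation_matrix P \<longleftrightarrow>
     (\<exists>\<pi>. \<pi> permutes UNIV \<and> P = (\<chi> i j. if j = \<pi> i then 1 else 0))"

definition generalized_negentropy :: "(real ^ 'n \<Rightarrow> ereal) \<Rightarrow> bool" where
  "generalized_negentropy \<Omega> \<longleftrightarrow>
     (\<forall>y. \<Omega> y \<noteq> -\<infinity>) \<and>
     (\<forall>y. \<Omega> y < \<infinity> \<longleftrightarrow> y \<in> prob_simplex) \<and>
     (\<forall>i. \<Omega> (axis i 1) = 0) \<and>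
     (\<forall>x\<in>prob_simplex. \<forall>y\<in>prob_simplex. \<forall>u\<in>{0<..<1}. x \<noteq> y \<longrightarrow>
        \<Omega> (u *\<^sub>R x + (1 - u) *\<^sub>R y) < ereal u * \<Omega> x + ereal (1 - u) * \<Omega> y) \<and>
     (\<forall>P y. permutation_matrix P \<longrightarrow> \<Omega> (P *v y) = \<Omega> y)"

definition conjugate :: "(real ^ 'n \<Rightarrow> ereal) \<Rightarrow> real ^ 'n \<Rightarrow> ereal" where
  "conjugate \<Omega> \<theta> = (SUP y. ereal (\<theta> \<bullet> y) - \<Omega> y)"

text \<open>A generalized negentropy need not be lower semicontinuous, so attainment of the
  maximum that defines the prediction map is a condition of its own.\<close>

definition maximum_attained :: "(real ^ 'n \<Rightarrow> ereal) \<Rightarrow> bool" where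
  "maximum_attained \<Omega> \<longleftrightarrow>
     (\<forall>\<theta>. \<exists>y. is_arg_max (\<lambda>y. ereal (\<theta> \<bullet> y) - \<Omega> y) (\<lambda>y. y \<in> prob_simplex) y)"

text \<open>When the maximum is attained, strict convexity makes the maximizer unique.\<close>

definition prediction :: "(real ^ 'n \<Rightarrow> ereal) \<Rightarrow> real ^ 'n \<Rightarrow> real ^ 'n" where
  "prediction \<Omega> \<theta> = arg_max_on (\<lambda>y. ereal (\<theta> \<bullet> y) - \<Omega> y) prob_simplex"

definition fenchel_young_loss ::
  "(real ^ 'n \<Rightarrow> ereal) \<Rightarrow> real ^ 'n \<Rightarrow> real ^ 'n \<Rightarrow> ereal" where
  "fenchel_young_loss \<Omega> \<theta> y = \<Omega> y + conjugate \<Omega> \<theta> - ereal (\<theta> \<bullet> y)"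

text \<open>The supremum over the finite set of indices other than \<open>i\<close> is the maximum over
  them; it is \<open>-\<infinity>\<close> if there is no other index.
  The same holds for \<open>separation\<close> below.\<close>

definition gap :: "real ^ 'n \<Rightarrow> 'n \<Rightarrow> ereal" where
  "gap \<theta> i = ereal (\<theta> $ i) - (SUP j\<in>-{i}. ereal (\<theta> $ j))"

definition margin_condition :: "(real ^ 'n \<Rightarrow> real ^ 'n \<Rightarrow> ereal) \<Rightarrow> real \<Rightarrow> bool" where
  "margin_condition L m \<longleftrightarrow>
     0 \<le> m \<and> (\<forall>i \<theta>. L \<theta> (axis i 1) = 0 \<longleftrightarrow> gap \<theta> i \<ge> ereal m)"

definition is_margin :: "(real ^ 'n \<Rightarrow> real ^ 'n \<Rightarrow> ereal) \<Rightarrow> real \<Rightarrow> bool" where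
  "is_margin L m \<longleftrightarrow>
     margin_condition L m \<and> (\<forall>m'. margin_condition L m' \<longrightarrow> m \<le> m')"

definition uniform :: "real ^ 'n" where
  "uniform = (\<chi> i. 1 / real CARD('n))"

definition pattern_mean :: "real ^ 'd ^ 'n \<Rightarrow> real ^ 'd" where
  "pattern_mean X = transpose X *v uniform"

definition max_norm :: "real ^ 'd ^ 'n \<Rightarrow> real" where
  "max_norm X = Max (range (\<lambda>k. norm (row k X)))"

definition hfy_energy ::
  "real ^ 'd ^ 'n \<Rightarrow> real \<Rightarrow> (real ^ 'n \<Rightarrow> ereal) \<Rightarrow> real ^ 'd \<Rightarrow> real" where
  "hfy_energy X \<beta> \<Omega> q =
     - (1 / \<beta>) * real_of_ereal (fenchel_young_loss \<Omega> (\<beta> *\<^sub>R (X *v q)) uniform)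
     + 1 / 2 * (norm (q - pattern_mean X))\<^sup>2
     + 1 / 2 * ((max_norm X)\<^sup>2 - (norm (pattern_mean X))\<^sup>2)"

definition stationary_point :: "(real ^ 'd \<Rightarrow> real) \<Rightarrow> real ^ 'd \<Rightarrow> bool" where
  "stationary_point E q \<longleftrightarrow> GDERIV E q :> 0"

definition hfy_update ::
  "real ^ 'd ^ 'n \<Rightarrow> real \<Rightarrow> (real ^ 'n \<Rightarrow> ereal) \<Rightarrow> real ^ 'd \<Rightarrow> real ^ 'd" where
  "hfy_update X \<beta> \<Omega> q = transpose X *v prediction \<Omega> (\<beta> *\<^sub>R (X *v q))"

definition separation :: "real ^ 'd ^ 'n \<Rightarrow> 'n \<Rightarrow> ereal" where
  "separation X i =
     ereal (row i X \<bullet> row i X) - (SUP j\<in>-{i}. ereal (row i X \<bullet> row j X))"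

end

theory Submission
  imports Defs
begin

text \<open>The energy is \<open>E q = (q \<bullet> q) / 2 - c (\<beta> X q) / \<beta> + const\<close> with \<open>c\<close> the conjugate of
  \<open>\<Omega>\<close>. Every maximizer is a subgradient of \<open>c\<close>, so stationarity at \<open>x\<^sub>i\<close> forces
  \<open>x\<^sub>i = X\<^sup>T y\<close> for the predicted \<open>y\<close>, hence \<open>y = e\<^sub>i\<close> because \<open>x\<^sub>i\<close> is outside the hull of the
  other patterns, and the margin condition applies.

  Conversely \<open>c\<close> must be differentiable at every \<open>\<theta>\<close> with gap at least \<open>m\<close>, although \<open>\<Omega>\<close>
  need not be lower semicontinuous. Averaging \<open>y\<close> over the permutations that fix \<open>i\<close> does not
  increase \<open>\<Omega>\<close> and moves \<open>y\<close> to the segment from \<open>e\<^sub>i\<close> to the uniform distribution on the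
  other coordinates. On this segment \<open>\<Omega> y + m (1 - y\<^sub>i)\<close> is strictly convex, nonnegative by the
  margin condition, and zero at \<open>e\<^sub>i\<close>, so it is bounded away from zero off \<open>e\<^sub>i\<close>. Hence
  maximizers for parameters near \<open>\<theta>\<close> are near \<open>e\<^sub>i\<close>, which makes \<open>e\<^sub>i\<close> the gradient of \<open>c\<close>.\<close>

section \<open>Quadratic term and extended-real differences\<close>

lemma has_derivative_half_inner_self:
  fixes x :: "'a :: real_inner"
  shows "((\<lambda>x. x \<bullet> x / 2) has_derivative (\<lambda>h. h \<bullet> x)) (at x)"
proof -
  have "((\<lambda>x. x \<bullet> x) has_derivative (\<lambda>h. x \<bullet> h + h \<bullet> x)) (at x)"
    by (intro has_derivative_inner has_derivative_ident)
  from has_derivative_mult_right[OF this, of "1 / 2"] show ?thesis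
    by (simp add: inner_commute)
qed

text \<open>Serves \<open>gap\<close> and \<open>separation\<close> alike. For empty
  \<open>A\<close> the supremum is \<open>-\<infinity>\<close>, the difference is
  \<open>\<infinity>\<close>, and both sides hold.\<close>

lemma ereal_minus_SUP_ge_iff:
  fixes b :: "'a \<Rightarrow> real"
  shows "ereal a - (SUP j\<in>A. ereal (b j)) \<ge> ereal c \<longleftrightarrow> (\<forall>j\<in>A. c \<le> a - b j)"
proof -
  have "ereal a - (SUP j\<in>A. ereal (b j)) \<ge> ereal c \<longleftrightarrow> (SUP j\<in>A. ereal (b j)) \<le> ereal (a - c)"
    by (cases "SUP j\<in>A. ereal (b j)") auto
  also have "\<dots> \<longleftrightarrow> (\<forall>j\<in>A. c \<le> a - b j)"
    by (simp add: SUP_le_iff algebra_simps)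
  finally show ?thesis .
qed

lemma gap_ge_iff: "gap \<theta> i \<ge> ereal m \<longleftrightarrow> (\<forall>j. j \<noteq> i \<longrightarrow> m \<le> \<theta> $ i - \<theta> $ j)"
  unfolding gap_def ereal_minus_SUP_ge_iff by auto

lemma separation_ge_iff:
  "separation X i \<ge> ereal m \<longleftrightarrow> (\<forall>j. j \<noteq> i \<longrightarrow> m \<le> row i X \<bullet> (row i X - row j X))"
  unfolding separation_def ereal_minus_SUP_ge_iff by (auto simp: inner_diff_right)

section \<open>The probability simplex near a vertex\<close>

lemma prob_simplexD:
  assumes "y \<in> prob_simplex"
  shows "0 \<le> y $ i" "(\<Sum>j\<in>UNIV. y $ j) = 1"
  using assms by (auto simp: prob_simplex_def)

lemma sum_others_prob_simplex:
  assumes "y \<in> prob_simplex"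
  shows "(\<Sum>j\<in>-{i}. y $ j) = 1 - y $ i"
proof -
  have "(\<Sum>j\<in>UNIV. y $ j) = y $ i + (\<Sum>j\<in>UNIV-{i}. y $ j)"
    by (intro sum.remove) auto
  then show ?thesis
    using prob_simplexD(2)[OF assms] by (simp add: Compl_eq_Diff_UNIV)
qed

lemma prob_simplex_le_one:
  assumes "y \<in> prob_simplex"
  shows "y $ i \<le> 1"
proof -
  have "0 \<le> (\<Sum>j\<in>-{i}. y $ j)"
    by (intro sum_nonneg prob_simplexD[OF assms])
  then show ?thesis
    using sum_others_prob_simplex[OF assms, of i] by simp
qed

text \<open>The bound is the 1-norm of the difference: coordinate \<open>i\<close> loses
  \<open>1 - y $ i\<close> and the others gain the same total. Closeness to the vertex thus becomes
  a condition on one coordinate.\<close>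

lemma norm_diff_axis_le:
  assumes "y \<in> prob_simplex"
  shows "norm (y - axis i 1) \<le> 2 * (1 - y $ i)"
proof -
  have "norm (y - axis i 1) \<le> (\<Sum>j\<in>UNIV. \<bar>(y - axis i 1) $ j\<bar>)"
    by (rule norm_le_l1_cart)
  also have "\<dots> = \<bar>(y - axis i 1) $ i\<bar> + (\<Sum>j\<in>UNIV-{i}. \<bar>(y - axis i 1) $ j\<bar>)"
    by (intro sum.remove) auto
  also have "(\<Sum>j\<in>UNIV-{i}. \<bar>(y - axis i 1) $ j\<bar>) = (\<Sum>j\<in>-{i}. y $ j)"
    by (intro sum.cong) (auto simp: axis_def prob_simplexD[OF assms] Compl_eq_Diff_UNIV)
  also have "\<bar>(y - axis i 1) $ i\<bar> = 1 - y $ i"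
    using prob_simplex_le_one[OF assms, of i] by simp
  finally show ?thesis
    by (simp add: sum_others_prob_simplex[OF assms])
qed

lemma prob_simplex_eq_axis:
  assumes "y \<in> prob_simplex" "y $ i = 1"
  shows "y = axis i 1"
  using norm_diff_axis_le[OF assms(1), of i] assms(2) by simp

lemma axis_in_prob_simplex: "axis i 1 \<in> prob_simplex"
  by (auto simp: prob_simplex_def axis_def)

lemma convex_prob_simplex: "convex prob_simplex"
  by (auto simp: convex_def prob_simplex_def sum.distrib sum_distrib_left[symmetric])

lemma uniform_in_prob_simplex: "uniform \<in> prob_simplex"
  by (auto simp: prob_simplex_def uniform_def)

text \<open>Each unit of mass placed off \<open>i\<close> costs at least \<open>m\<close>, and the
  mass off \<open>i\<close> is \<open>1 - y $ i\<close>.\<close>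

lemma inner_prob_simplex_le:
  assumes "y \<in> prob_simplex" "\<And>j. j \<noteq> i \<Longrightarrow> m \<le> \<theta> $ i - \<theta> $ j"
  shows "\<theta> \<bullet> y \<le> \<theta> $ i - m * (1 - y $ i)"
proof -
  have "\<theta> \<bullet> y = \<theta> $ i * y $ i + (\<Sum>j\<in>UNIV-{i}. \<theta> $ j * y $ j)"
    unfolding inner_vec_def inner_real_def by (intro sum.remove) auto
  also have "(\<Sum>j\<in>UNIV-{i}. \<theta> $ j * y $ j) \<le> (\<Sum>j\<in>UNIV-{i}. (\<theta> $ i - m) * y $ j)"
    using assms(2) by (intro sum_mono mult_right_mono prob_simplexD[OF assms(1)]) force
  also have "\<dots> = (\<theta> $ i - m) * (1 - y $ i)"
    using sum_others_prob_simplex[OF assms(1), of i]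
    by (simp add: sum_distrib_left[symmetric] Compl_eq_Diff_UNIV)
  finally show ?thesis
    by (simp add: algebra_simps)
qed

section \<open>Convex combinations of the patterns\<close>

lemma transpose_mult_eq_sum_rows:
  fixes X :: "real ^ 'd ^ 'n"
  shows "transpose X *v y = (\<Sum>j\<in>UNIV. y $ j *\<^sub>R row j X)"
  by (simp add: vec_eq_iff matrix_vector_mult_def transpose_def row_def mult.commute)

lemma transpose_mult_axis:
  fixes X :: "real ^ 'd ^ 'n"
  shows "transpose X *v axis i 1 = row i X"
  by (simp add: matrix_vector_mul_component column_transpose matrix_vector_mult_basis)

lemma inner_matrix_transpose:
  fixes X :: "real ^ 'd ^ 'n"
  shows "(X *v q) \<bullet> y = q \<bullet> (transpose X *v y)"
  by (metis dot_lmul_matrix inner_commute transpose_matrix_vector)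

text \<open>If \<open>y $ i < 1\<close>, the equation can be solved for \<open>row i X\<close>,
  which becomes a convex combination of the other rows with weights
  \<open>y $ j / (1 - y $ i)\<close>.\<close>

lemma eq_axis_of_notin_hull:
  fixes X :: "real ^ 'd ^ 'n"
  assumes "y \<in> prob_simplex" "transpose X *v y = row i X"
    and notin: "row i X \<notin> convex hull ((\<lambda>j. row j X) ` (-{i}))"
  shows "y = axis i 1"
proof (rule prob_simplex_eq_axis[OF assms(1)], rule ccontr)
  assume "y $ i \<noteq> 1"
  then have less: "y $ i < 1"
    using prob_simplex_le_one[OF assms(1), of i] by simp
  have "transpose X *v y = y $ i *\<^sub>R row i X + (\<Sum>j\<in>UNIV-{i}. y $ j *\<^sub>R row j X)"
    unfolding transpose_mult_eq_sum_rows by (intro sum.remove) auto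
  then have "row i X = y $ i *\<^sub>R row i X + (\<Sum>j\<in>UNIV-{i}. y $ j *\<^sub>R row j X)"
    by (simp only: assms(2))
  then have eq: "(1 - y $ i) *\<^sub>R row i X = (\<Sum>j\<in>-{i}. y $ j *\<^sub>R row j X)"
    by (simp add: algebra_simps Compl_eq_Diff_UNIV)
  have "row i X = (1 / (1 - y $ i)) *\<^sub>R (\<Sum>j\<in>-{i}. y $ j *\<^sub>R row j X)"
    unfolding eq[symmetric] using less by simp
  also have "\<dots> = (\<Sum>j\<in>-{i}. (y $ j / (1 - y $ i)) *\<^sub>R row j X)"
    by (simp add: scaleR_sum_right)
  also have "\<dots> \<in> convex hull ((\<lambda>j. row j X) ` (-{i}))"
  proof (rule convex_sum)
    show "(\<Sum>j\<in>-{i}. y $ j / (1 - y $ i)) = 1"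
      using less by (simp add: sum_divide_distrib[symmetric] sum_others_prob_simplex[OF assms(1)])
  qed (use less prob_simplexD[OF assms(1)] in \<open>auto intro: hull_inc\<close>)
  finally show False
    using notin by simp
qed

section \<open>Averaging over permutations that fix a coordinate\<close>

lemma permutation_matrix_mult:
  "(\<chi> k j. if j = \<pi> k then 1 else 0) *v y = (\<chi> k. (y :: real ^ 'n) $ \<pi> k)"
  by (simp add: vec_eq_iff matrix_vector_mult_def if_distrib[of "\<lambda>x. x * _"] cong: if_cong)

text \<open>With a single index this is the zero vector, outside the simplex; membership therefore
  asks for a second index.\<close>

definition others_uniform :: "'n \<Rightarrow> real ^ 'n" where
  "others_uniform i = (\<chi> j. if j = i then 0 else 1 / real (CARD('n) - 1))"

lemma others_uniform_in_prob_simplex: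
  assumes "(j :: 'n) \<noteq> i"
  shows "(others_uniform i :: real ^ 'n) \<in> prob_simplex"
proof -
  have "(\<Sum>k\<in>UNIV. others_uniform i $ k) = (\<Sum>k\<in>UNIV-{i}. 1 / real (CARD('n) - 1))"
    by (intro sum.mono_neutral_cong_right) (auto simp: others_uniform_def)
  also have "\<dots> = real (CARD('n) - 1) / real (CARD('n) - 1)"
    by (simp add: card_Diff_singleton)
  also have "CARD('n) - 1 \<noteq> 0"
    using assms card_le_Suc0_iff_eq[of "UNIV :: 'n set"] by auto
  then have "real (CARD('n) - 1) / real (CARD('n) - 1) = 1"
    by simp
  finally show ?thesis
    by (auto simp: prob_simplex_def others_uniform_def)
qed

text \<open>The sum over all permutations fixing \<open>i\<close> is invariant under transpositions of the other
  coordinates, so its coordinates other than \<open>i\<close> agree without any counting.\<close>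

lemma average_permutations_fixing:
  fixes y :: "real ^ 'n" and i :: 'n
  assumes y: "y \<in> prob_simplex"
  defines "G \<equiv> {\<pi>. \<pi> permutes (-{i})}"
  shows "(\<Sum>\<pi>\<in>G. (1 / real (card G)) *\<^sub>R (\<chi> k. y $ \<pi> k))
       = y $ i *\<^sub>R axis i 1 + (1 - y $ i) *\<^sub>R others_uniform i"
proof -
  define w where "w = (\<Sum>\<pi>\<in>G. (1 / real (card G)) *\<^sub>R (\<chi> k. y $ \<pi> k))"
  have G: "finite G" "card G \<noteq> 0"
    using card_permutations[of "-{i}" "card (-{i})"] finite_permutations[of "-{i}"]
    by (auto simp: G_def)
  have comp: "w $ k = (\<Sum>\<pi>\<in>G. y $ \<pi> k) / real (card G)" for k
    by (simp add: w_def sum_divide_distrib)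
  have i: "w $ i = y $ i"
  proof -
    have "(\<Sum>\<pi>\<in>G. y $ \<pi> i) = (\<Sum>\<pi>\<in>G. y $ i)"
      by (intro sum.cong) (auto simp: G_def permutes_def)
    then show ?thesis
      using G by (simp add: comp)
  qed
  have sym: "w $ j = w $ k" if "j \<noteq> i" "k \<noteq> i" for j k
  proof -
    have "Transposition.transpose j k permutes (-{i})"
      using that by (intro permutes_swap_id) auto
    then have "(\<Sum>\<pi>\<in>G. y $ \<pi> j) = (\<Sum>\<pi>\<in>G. y $ (\<pi> \<circ> Transposition.transpose j k) j)"
      unfolding G_def by (rule sum_permutations_compose_right)
    then show ?thesis
      by (simp add: comp)
  qed
  have sum: "(\<Sum>k\<in>UNIV. w $ k) = 1"
  proof -
    have "(\<Sum>k\<in>UNIV. w $ k) = (\<Sum>\<pi>\<in>G. \<Sum>k\<in>UNIV. y $ \<pi> k) / real (card G)"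
      unfolding comp sum_divide_distrib[symmetric] by (subst sum.swap) simp
    also have "(\<Sum>\<pi>\<in>G. \<Sum>k\<in>UNIV. y $ \<pi> k) = (\<Sum>\<pi>\<in>G. 1)"
    proof (rule sum.cong)
      fix \<pi> assume "\<pi> \<in> G"
      then have "\<pi> permutes UNIV"
        unfolding G_def by (auto intro: permutes_subset)
      then show "(\<Sum>k\<in>UNIV. y $ \<pi> k) = 1"
        using sum.permute[of \<pi> UNIV "\<lambda>k. y $ k"] prob_simplexD(2)[OF y] by (simp add: o_def)
    qed simp
    finally show ?thesis
      using G by simp
  qed
  have "w $ j = (1 - y $ i) / real (CARD('n) - 1)" if j: "j \<noteq> i" for j
  proof -
    have "1 = w $ i + (\<Sum>k\<in>UNIV-{i}. w $ k)"
      using sum by (simp add: sum.remove[of UNIV i])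
    also have "(\<Sum>k\<in>UNIV-{i}. w $ k) = (\<Sum>k\<in>UNIV-{i}. w $ j)"
      using j by (intro sum.cong) (auto intro: sym)
    also have "\<dots> = real (CARD('n) - 1) * w $ j"
      by (simp add: card_Diff_singleton)
    finally have "real (CARD('n) - 1) * w $ j = 1 - y $ i"
      using i by simp
    moreover have "CARD('n) - 1 \<noteq> 0"
      using j card_le_Suc0_iff_eq[of "UNIV :: 'n set"] by auto
    ultimately show ?thesis
      by (simp add: field_simps)
  qed
  then have "w = y $ i *\<^sub>R axis i 1 + (1 - y $ i) *\<^sub>R others_uniform i"
    using i by (auto simp: vec_eq_iff others_uniform_def axis_def)
  then show ?thesis
    by (simp add: w_def)
qed

section \<open>Convexity and symmetry of a negentropy, and its growth away from a vertex\<close>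

context
  fixes \<Omega> :: "real ^ 'n \<Rightarrow> ereal"
  assumes negentropy: "generalized_negentropy \<Omega>"
begin

lemma negentropy_eq_real: "y \<in> prob_simplex \<Longrightarrow> \<Omega> y = ereal (real_of_ereal (\<Omega> y))"
  using negentropy unfolding generalized_negentropy_def by (metis ereal_real less_irrefl abs_eq_infinity_cases)

lemma negentropy_eq_infinity: "y \<notin> prob_simplex \<Longrightarrow> \<Omega> y = \<infinity>"
  using negentropy unfolding generalized_negentropy_def by (metis less_ereal.simps(2) ereal_infty_less(1))

lemma negentropy_axis: "\<Omega> (axis i 1) = 0"
  using negentropy unfolding generalized_negentropy_def by blast

lemma negentropy_strictly_convex:
  assumes "x \<in> prob_simplex" "y \<in> prob_simplex" "x \<noteq> y" "0 < u" "u < 1"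
  shows "real_of_ereal (\<Omega> (u *\<^sub>R x + (1 - u) *\<^sub>R y))
       < u * real_of_ereal (\<Omega> x) + (1 - u) * real_of_ereal (\<Omega> y)"
proof -
  have "u *\<^sub>R x + (1 - u) *\<^sub>R y \<in> prob_simplex"
    using assms by (intro convexD[OF convex_prob_simplex]) auto
  moreover have "\<Omega> (u *\<^sub>R x + (1 - u) *\<^sub>R y) < ereal u * \<Omega> x + ereal (1 - u) * \<Omega> y"
    using negentropy assms unfolding generalized_negentropy_def by auto
  ultimately have "ereal (real_of_ereal (\<Omega> (u *\<^sub>R x + (1 - u) *\<^sub>R y)))
      < ereal u * ereal (real_of_ereal (\<Omega> x)) + ereal (1 - u) * ereal (real_of_ereal (\<Omega> y))"
    using assms(1,2) negentropy_eq_real by metis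
  then show ?thesis
    by simp
qed

lemma negentropy_convex: "convex_on prob_simplex (\<lambda>y. real_of_ereal (\<Omega> y))"
proof (rule convex_onI[OF _ convex_prob_simplex])
  fix t :: real and x y :: "real ^ 'n"
  assume *: "0 < t" "t < 1" "x \<in> prob_simplex" "y \<in> prob_simplex"
  show "real_of_ereal (\<Omega> ((1 - t) *\<^sub>R x + t *\<^sub>R y))
      \<le> (1 - t) * real_of_ereal (\<Omega> x) + t * real_of_ereal (\<Omega> y)"
  proof (cases "x = y")
    case True
    then show ?thesis
      by (simp add: scaleR_left.add[symmetric] distrib_right[symmetric])
  next
    case False
    then show ?thesis
      using negentropy_strictly_convex[of x y "1 - t"] * by simp
  qed
qed

lemma negentropy_permute: "\<pi> permutes UNIV \<Longrightarrow> \<Omega> (\<chi> k. y $ \<pi> k) = \<Omega> y"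
proof -
  assume "\<pi> permutes UNIV"
  then have "permutation_matrix (\<chi> k j. if j = \<pi> k then 1 else 0)"
    unfolding permutation_matrix_def by blast
  then have "\<Omega> ((\<chi> k j. if j = \<pi> k then 1 else 0) *v y) = \<Omega> y"
    using negentropy unfolding generalized_negentropy_def by blast
  then show ?thesis
    by (simp only: permutation_matrix_mult)
qed

text \<open>Jensen's inequality with equal weights: all permuted copies of \<open>y\<close> have the
  same value under \<open>\<Omega>\<close>.\<close>

lemma negentropy_symmetrize_le:
  assumes y: "y \<in> prob_simplex"
  shows "real_of_ereal (\<Omega> (y $ i *\<^sub>R axis i 1 + (1 - y $ i) *\<^sub>R others_uniform i))
       \<le> real_of_ereal (\<Omega> y)"
proof -
  define G where "G = {\<pi>. \<pi> permutes (-{i})}"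
  have UNIV: "\<pi> permutes UNIV" if "\<pi> \<in> G" for \<pi>
    using that unfolding G_def by (auto intro: permutes_subset)
  have G: "finite G" "card G \<noteq> 0"
    using card_permutations[of "-{i}" "card (-{i})"] finite_permutations[of "-{i}"]
    by (auto simp: G_def)
  have simplex: "(\<chi> k. y $ \<pi> k) \<in> prob_simplex" if "\<pi> \<in> G" for \<pi>
    using sum.permute[OF UNIV[OF that], of "\<lambda>k. y $ k"] y by (simp add: prob_simplex_def o_def)
  have "real_of_ereal (\<Omega> (\<Sum>\<pi>\<in>G. (1 / real (card G)) *\<^sub>R (\<chi> k. y $ \<pi> k)))
      \<le> (\<Sum>\<pi>\<in>G. 1 / real (card G) * real_of_ereal (\<Omega> (\<chi> k. y $ \<pi> k)))"
    using G by (intro convex_on_sum[OF _ _ negentropy_convex] simplex) auto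
  also have "\<dots> = real_of_ereal (\<Omega> y)"
    using G by (simp add: negentropy_permute UNIV)
  finally show ?thesis
    unfolding G_def average_permutations_fixing[OF y] .
qed

text \<open>The hypothesis \<open>lower\<close> is the margin condition read at \<open>\<theta> = m e\<^sub>i\<close>, a parameter of gap
  exactly \<open>m\<close>.\<close>

lemma negentropy_bounded_away:
  assumes lower: "\<And>y. y \<in> prob_simplex \<Longrightarrow> 0 \<le> real_of_ereal (\<Omega> y) + m * (1 - y $ i)"
    and \<epsilon>: "0 < \<epsilon>" "\<epsilon> < 1"
  obtains \<delta> where "0 < \<delta>"
    "\<And>y. y \<in> prob_simplex \<Longrightarrow> y $ i \<le> 1 - \<epsilon> \<Longrightarrow> \<delta> \<le> real_of_ereal (\<Omega> y) + m * (1 - y $ i)"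
proof (cases "\<exists>j. j \<noteq> i")
  \<comment> \<open>With a single index every simplex point has \<open>y $ i = 1\<close>, so no
    point satisfies \<open>y $ i \<le> 1 - \<epsilon>\<close> and any positive bound does.\<close>
  case False
  have "y $ i = 1" if "y \<in> prob_simplex" for y :: "real ^ 'n"
  proof -
    have "-{i} = {}"
      using False by auto
    then show ?thesis
      using sum_others_prob_simplex[OF that, of i] by simp
  qed
  then show ?thesis
    using that[of 1] \<epsilon> by fastforce
next
  case True
  let ?e = "axis i 1 :: real ^ 'n" and ?u = "others_uniform i :: real ^ 'n"
  define s where "s a = a *\<^sub>R ?e + (1 - a) *\<^sub>R ?u" for a :: real
  \<comment> \<open>The function to be bounded, restricted to the segment. The penalty is affine in
    \<open>a\<close> and \<open>k 1 = 0\<close>.\<close>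
  define k where "k a = real_of_ereal (\<Omega> (s a)) + m * (1 - a)" for a
  have u: "?u \<in> prob_simplex"
    using True others_uniform_in_prob_simplex by blast
  have s_i: "s a $ i = a" for a
    by (simp add: s_def others_uniform_def)
  have s: "s a \<in> prob_simplex" if "0 \<le> a" "a \<le> 1" for a
    unfolding s_def using that
    by (intro convexD[OF convex_prob_simplex] axis_in_prob_simplex u) auto
  have k_nonneg: "0 \<le> k a" if "0 \<le> a" "a \<le> 1" for a
    using lower[OF s[OF that]] by (simp add: k_def s_i)
  \<comment> \<open>Strict convexity between \<open>a\<close> and 1, where \<open>k\<close> vanishes
    and so contributes nothing.\<close>
  have k_less: "k (t * a + (1 - t)) < t * k a" if "0 \<le> a" "a < 1" "0 < t" "t < 1" for a t
  proof -
    have "s a \<noteq> ?e"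
      using that s_i[of a] by auto
    then have "real_of_ereal (\<Omega> (t *\<^sub>R s a + (1 - t) *\<^sub>R ?e))
        < t * real_of_ereal (\<Omega> (s a)) + (1 - t) * real_of_ereal (\<Omega> ?e)"
      using that by (intro negentropy_strictly_convex s axis_in_prob_simplex) auto
    moreover have "t *\<^sub>R s a + (1 - t) *\<^sub>R ?e = s (t * a + (1 - t))"
      by (simp add: s_def algebra_simps)
    ultimately show ?thesis
      by (simp add: k_def negentropy_axis algebra_simps)
  qed
  have k_pos: "0 < k a" if "0 \<le> a" "a < 1" for a
  proof -
    \<comment> \<open>The midpoint of \<open>a\<close> and 1 turns nonnegativity into positivity:
      its value is at least 0 and below \<open>k a / 2\<close>.\<close>
    have "0 \<le> k (1 / 2 * a + (1 - 1 / 2))"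
      using that by (intro k_nonneg) auto
    then show ?thesis
      using k_less[of a "1 / 2"] that by simp
  qed
  have k_le: "k (1 - \<epsilon>) \<le> k a" if a: "0 \<le> a" "a \<le> 1 - \<epsilon>" for a
  proof (cases "a = 1 - \<epsilon>")
    case False
    \<comment> \<open>Solves \<open>t * a + (1 - t) = 1 - \<epsilon>\<close>, which places
      \<open>1 - \<epsilon>\<close> between \<open>a\<close> and 1.\<close>
    define t where "t = \<epsilon> / (1 - a)"
    have t: "0 < t" "t < 1" "t * (1 - a) = \<epsilon>"
      using a False \<epsilon> by (auto simp: t_def)
    have "k (t * a + (1 - t)) < t * k a"
      using a t \<epsilon> by (intro k_less) auto
    moreover have "t * a + (1 - t) = 1 - \<epsilon>"
      using t(3) by (simp add: algebra_simps)
    ultimately have "k (1 - \<epsilon>) < t * k a"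
      by (simp only:)
    also have "\<dots> \<le> k a"
      using k_nonneg[of a] a t \<epsilon> by (simp add: mult_left_le_one_le)
    finally show ?thesis
      by simp
  qed simp
  show ?thesis
  proof (rule that)
    show "0 < k (1 - \<epsilon>)"
      using \<epsilon> by (intro k_pos) auto
    fix y :: "real ^ 'n"
    assume y: "y \<in> prob_simplex" "y $ i \<le> 1 - \<epsilon>"
    have "k (1 - \<epsilon>) \<le> k (y $ i)"
      using prob_simplexD[OF y(1)] y(2) by (intro k_le)
    also have "\<dots> \<le> real_of_ereal (\<Omega> y) + m * (1 - y $ i)"
      using negentropy_symmetrize_le[OF y(1), of i] by (simp add: k_def s_def)
    finally show "k (1 - \<epsilon>) \<le> real_of_ereal (\<Omega> y) + m * (1 - y $ i)" .
  qed
qed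

section \<open>Maximizers, the conjugate and the loss\<close>

lemma maximizer_iff:
  "is_arg_max (\<lambda>y. ereal (\<theta> \<bullet> y) - \<Omega> y) (\<lambda>y. y \<in> prob_simplex) x \<longleftrightarrow>
    x \<in> prob_simplex \<and>
    (\<forall>y\<in>prob_simplex. \<theta> \<bullet> y - real_of_ereal (\<Omega> y) \<le> \<theta> \<bullet> x - real_of_ereal (\<Omega> x))"
proof -
  have "ereal (\<theta> \<bullet> y) - \<Omega> y = ereal (\<theta> \<bullet> y - real_of_ereal (\<Omega> y))" if "y \<in> prob_simplex" for y
    by (subst negentropy_eq_real[OF that]) simp
  then show ?thesis
    unfolding is_arg_max_def by (auto simp: not_less)
qed

text \<open>The midpoint of two distinct maximizers would have a strictly larger value.\<close>

lemma maximizer_unique: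
  assumes x: "x \<in> prob_simplex"
      "\<And>y. y \<in> prob_simplex \<Longrightarrow> \<theta> \<bullet> y - real_of_ereal (\<Omega> y) \<le> \<theta> \<bullet> x - real_of_ereal (\<Omega> x)"
    and z: "z \<in> prob_simplex"
      "\<And>y. y \<in> prob_simplex \<Longrightarrow> \<theta> \<bullet> y - real_of_ereal (\<Omega> y) \<le> \<theta> \<bullet> z - real_of_ereal (\<Omega> z)"
  shows "x = z"
proof (rule ccontr)
  assume "x \<noteq> z"
  let ?w = "(1 / 2) *\<^sub>R x + (1 - 1 / 2) *\<^sub>R z"
  have "?w \<in> prob_simplex"
    by (intro convexD[OF convex_prob_simplex] x(1) z(1)) auto
  moreover have "real_of_ereal (\<Omega> ?w)
      < 1 / 2 * real_of_ereal (\<Omega> x) + (1 - 1 / 2) * real_of_ereal (\<Omega> z)"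
    using \<open>x \<noteq> z\<close> x(1) z(1) by (intro negentropy_strictly_convex) auto
  moreover have "\<theta> \<bullet> ?w = (\<theta> \<bullet> x + \<theta> \<bullet> z) / 2"
    by (simp add: inner_add_right)
  ultimately show False
    using x(2)[of ?w] x(2)[OF z(1)] z(2)[OF x(1)] by simp
qed

context
  assumes attained: "maximum_attained \<Omega>"
begin

text \<open>\<open>prediction\<close> is a choice term; attainment guarantees that the choice is a
  maximizer.\<close>

lemma prediction_maximizes:
  "prediction \<Omega> \<theta> \<in> prob_simplex"
  "y \<in> prob_simplex \<Longrightarrow> \<theta> \<bullet> y - real_of_ereal (\<Omega> y)
     \<le> \<theta> \<bullet> prediction \<Omega> \<theta> - real_of_ereal (\<Omega> (prediction \<Omega> \<theta>))"
proof -
  have "is_arg_max (\<lambda>y. ereal (\<theta> \<bullet> y) - \<Omega> y) (\<lambda>y. y \<in> prob_simplex) (prediction \<Omega> \<theta>)"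
    using attained unfolding maximum_attained_def prediction_def arg_max_on_def arg_max_def
    by (metis someI_ex)
  then show "prediction \<Omega> \<theta> \<in> prob_simplex"
    "y \<in> prob_simplex \<Longrightarrow> \<theta> \<bullet> y - real_of_ereal (\<Omega> y)
       \<le> \<theta> \<bullet> prediction \<Omega> \<theta> - real_of_ereal (\<Omega> (prediction \<Omega> \<theta>))"
    unfolding maximizer_iff by auto
qed

text \<open>Points off the simplex contribute \<open>-\<infinity>\<close> to the supremum. The
  conjugate is therefore finite, so \<open>real_of_ereal\<close> loses no information in what
  follows.\<close>

lemma conjugate_eq:
  "conjugate \<Omega> \<theta> = ereal (\<theta> \<bullet> prediction \<Omega> \<theta> - real_of_ereal (\<Omega> (prediction \<Omega> \<theta>)))"
  unfolding conjugate_def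
proof (rule SUP_eqI)
  fix y
  show "ereal (\<theta> \<bullet> y) - \<Omega> y
      \<le> ereal (\<theta> \<bullet> prediction \<Omega> \<theta> - real_of_ereal (\<Omega> (prediction \<Omega> \<theta>)))"
  proof (cases "y \<in> prob_simplex")
    case True
    show ?thesis
      by (subst negentropy_eq_real[OF True]) (simp add: prediction_maximizes(2)[OF True])
  qed (simp add: negentropy_eq_infinity)
next
  fix c
  assume "\<And>y. y \<in> UNIV \<Longrightarrow> ereal (\<theta> \<bullet> y) - \<Omega> y \<le> c"
  then have "ereal (\<theta> \<bullet> prediction \<Omega> \<theta>) - \<Omega> (prediction \<Omega> \<theta>) \<le> c"
    by blast
  then show "ereal (\<theta> \<bullet> prediction \<Omega> \<theta> - real_of_ereal (\<Omega> (prediction \<Omega> \<theta>))) \<le> c"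
    by (subst (asm) negentropy_eq_real[OF prediction_maximizes(1)]) simp
qed

lemma conjugate_ge:
  assumes "y \<in> prob_simplex"
  shows "\<theta> \<bullet> y - real_of_ereal (\<Omega> y) \<le> real_of_ereal (conjugate \<Omega> \<theta>)"
  using prediction_maximizes(2)[OF assms] by (simp add: conjugate_eq)

text \<open>The maximizer at \<open>\<theta>\<close> is a competitor at \<open>\<theta>'\<close>.
  This inequality carries both directions of the stationarity criterion.\<close>

lemma conjugate_subgradient:
  "real_of_ereal (conjugate \<Omega> \<theta>) + (\<theta>' - \<theta>) \<bullet> prediction \<Omega> \<theta>
     \<le> real_of_ereal (conjugate \<Omega> \<theta>')"
  using conjugate_ge[OF prediction_maximizes(1), of \<theta>' \<theta>]
  by (simp add: conjugate_eq[of \<theta>] inner_diff_left)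

lemma loss_eq:
  assumes "y \<in> prob_simplex"
  shows "fenchel_young_loss \<Omega> \<theta> y
       = ereal (real_of_ereal (\<Omega> y) + real_of_ereal (conjugate \<Omega> \<theta>) - \<theta> \<bullet> y)"
  unfolding fenchel_young_loss_def
  by (subst negentropy_eq_real[OF assms]) (simp add: conjugate_eq)

text \<open>Zero loss says that the vertex attains the supremum; uniqueness then identifies it with
  the prediction.\<close>

lemma loss_axis_eq_0_iff:
  "fenchel_young_loss \<Omega> \<theta> (axis i 1) = 0 \<longleftrightarrow> prediction \<Omega> \<theta> = axis i 1"
proof
  assume "fenchel_young_loss \<Omega> \<theta> (axis i 1) = 0"
  then have "real_of_ereal (conjugate \<Omega> \<theta>)
      = \<theta> \<bullet> axis i 1 - real_of_ereal (\<Omega> (axis i 1))"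
    by (simp add: loss_eq axis_in_prob_simplex negentropy_axis)
  then show "prediction \<Omega> \<theta> = axis i 1"
    using conjugate_ge[of _ \<theta>]
    by (intro maximizer_unique[of _ \<theta>] prediction_maximizes axis_in_prob_simplex) auto
next
  assume "prediction \<Omega> \<theta> = axis i 1"
  then show "fenchel_young_loss \<Omega> \<theta> (axis i 1) = 0"
    by (simp add: loss_eq axis_in_prob_simplex conjugate_eq)
qed

section \<open>Consequences of the margin: differentiability of the conjugate\<close>

context
  fixes m :: real
  assumes margin: "margin_condition (fenchel_young_loss \<Omega>) m"
begin

lemma prediction_eq_axis_iff:
  "prediction \<Omega> \<theta> = axis i 1 \<longleftrightarrow> (\<forall>j. j \<noteq> i \<longrightarrow> m \<le> \<theta> $ i - \<theta> $ j)"
  using margin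
  unfolding margin_condition_def loss_axis_eq_0_iff gap_ge_iff by blast

text \<open>At the parameter \<open>axis i m\<close> the vertex is the maximizer, with value
  \<open>m\<close>, while \<open>y\<close> has value \<open>m * y $ i - \<Omega> y\<close>.\<close>

lemma negentropy_margin_lower_bound:
  assumes "y \<in> prob_simplex"
  shows "0 \<le> real_of_ereal (\<Omega> y) + m * (1 - y $ i)"
proof -
  have "prediction \<Omega> (axis i m) = axis i 1"
    unfolding prediction_eq_axis_iff by (simp add: axis_def)
  then show ?thesis
    using prediction_maximizes(2)[OF assms, of "axis i m"]
    by (simp add: negentropy_axis inner_axis_axis inner_axis' algebra_simps)
qed

text \<open>Comparing the prediction at \<open>\<theta> + h\<close> with the vertex bounds the
  penalized negentropy by a multiple of \<open>norm h\<close>; a small value forces the prediction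
  close to the vertex.\<close>

lemma prediction_close_to_axis:
  assumes gap: "\<And>j. j \<noteq> i \<Longrightarrow> m \<le> \<theta> $ i - \<theta> $ j" and "0 < \<eta>"
  obtains \<delta> where "0 < \<delta>"
    "\<And>h. norm h < \<delta> \<Longrightarrow> norm (prediction \<Omega> (\<theta> + h) - axis i 1) \<le> \<eta>"
proof -
  \<comment> \<open>\<open>\<eta> / 2\<close> offsets the factor 2 in
    \<open>norm_diff_axis_le\<close>; the cap \<open>1 / 2\<close> keeps \<open>\<epsilon>\<close>
    below 1.\<close>
  define \<epsilon> where "\<epsilon> = min (1 / 2) (\<eta> / 2)"
  have \<epsilon>: "0 < \<epsilon>" "\<epsilon> < 1" "2 * \<epsilon> \<le> \<eta>"
    using \<open>0 < \<eta>\<close> by (auto simp: \<epsilon>_def)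
  obtain \<delta> where \<delta>: "0 < \<delta>" "\<And>y. y \<in> prob_simplex \<Longrightarrow> y $ i \<le> 1 - \<epsilon>
      \<Longrightarrow> \<delta> \<le> real_of_ereal (\<Omega> y) + m * (1 - y $ i)"
    using negentropy_bounded_away[OF negentropy_margin_lower_bound \<epsilon>(1,2)] by blast
  show ?thesis
  proof (rule that)
    show "0 < \<delta> / 2"
      using \<delta>(1) by simp
    fix h :: "real ^ 'n"
    assume h: "norm h < \<delta> / 2"
    let ?y = "prediction \<Omega> (\<theta> + h)"
    note y = prediction_maximizes(1)[of "\<theta> + h"]
    have "(\<theta> + h) \<bullet> axis i 1 \<le> (\<theta> + h) \<bullet> ?y - real_of_ereal (\<Omega> ?y)"
      using prediction_maximizes(2)[OF axis_in_prob_simplex, of "\<theta> + h" i]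
      by (simp add: negentropy_axis)
    then have "\<theta> $ i + h \<bullet> axis i 1 \<le> \<theta> \<bullet> ?y + h \<bullet> ?y - real_of_ereal (\<Omega> ?y)"
      by (simp add: inner_add_left inner_axis)
    moreover have "\<theta> \<bullet> ?y \<le> \<theta> $ i - m * (1 - ?y $ i)"
      using gap by (rule inner_prob_simplex_le[OF y])
    ultimately have "real_of_ereal (\<Omega> ?y) + m * (1 - ?y $ i) \<le> h \<bullet> (?y - axis i 1)"
      by (simp add: inner_diff_right)
    also have "\<dots> \<le> norm h * norm (?y - axis i 1)"
      by (rule norm_cauchy_schwarz)
    \<comment> \<open>Simplex points are within distance 2 of the vertex, hence the radius
      \<open>\<delta> / 2\<close>.\<close>
    also have "\<dots> \<le> norm h * 2"
      using norm_diff_axis_le[OF y, of i] prob_simplexD(1)[OF y, of i]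
      by (intro mult_left_mono) auto
    also have "\<dots> < \<delta>"
      using h by simp
    finally have "1 - \<epsilon> < ?y $ i"
      using \<delta>(2)[OF y] by (auto simp: not_le[symmetric])
    then show "norm (?y - axis i 1) \<le> \<eta>"
      using norm_diff_axis_le[OF y, of i] \<epsilon>(3) by simp
  qed
qed

text \<open>The subgradient inequalities at \<open>\<theta>\<close> and at \<open>z\<close> trap the
  remainder between 0 and
  \<open>(z - \<theta>) \<bullet> (prediction \<Omega> z - axis i 1)\<close>, whose second factor is
  small.\<close>

lemma conjugate_gderiv:
  assumes gap: "\<And>j. j \<noteq> i \<Longrightarrow> m \<le> \<theta> $ i - \<theta> $ j"
  shows "GDERIV (\<lambda>\<theta>. real_of_ereal (conjugate \<Omega> \<theta>)) \<theta> :> axis i 1"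
  unfolding gderiv_def has_derivative_at_alt
proof (intro conjI allI impI)
  let ?c = "\<lambda>\<theta>. real_of_ereal (conjugate \<Omega> \<theta>)"
  show "bounded_linear (\<lambda>h. h \<bullet> axis i 1 :: real)"
    by (rule bounded_linear_inner_left)
  fix \<eta> :: real
  assume "0 < \<eta>"
  obtain \<delta> where \<delta>: "0 < \<delta>"
    "\<And>h. norm h < \<delta> \<Longrightarrow> norm (prediction \<Omega> (\<theta> + h) - axis i 1) \<le> \<eta>"
    using prediction_close_to_axis[OF gap \<open>0 < \<eta>\<close>] by blast
  have "norm (?c z - ?c \<theta> - (z - \<theta>) \<bullet> axis i 1) \<le> \<eta> * norm (z - \<theta>)"
    if "norm (z - \<theta>) < \<delta>" for z
  proof -
    let ?y = "prediction \<Omega> z"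
    have "prediction \<Omega> \<theta> = axis i 1"
      using gap by (simp add: prediction_eq_axis_iff)
    then have "0 \<le> ?c z - ?c \<theta> - (z - \<theta>) \<bullet> axis i 1"
      using conjugate_subgradient[of \<theta> z] by simp
    moreover have "?c z - ?c \<theta> - (z - \<theta>) \<bullet> axis i 1 \<le> (z - \<theta>) \<bullet> (?y - axis i 1)"
      using conjugate_subgradient[of z \<theta>] by (simp add: inner_diff_left inner_diff_right)
    moreover have "(z - \<theta>) \<bullet> (?y - axis i 1) \<le> norm (z - \<theta>) * norm (?y - axis i 1)"
      by (rule norm_cauchy_schwarz)
    moreover have "\<dots> \<le> norm (z - \<theta>) * \<eta>"
      using \<delta>(2)[OF that] by (intro mult_left_mono) auto
    ultimately show ?thesis
      by (simp add: mult.commute)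
  qed
  then show "\<exists>d>0. \<forall>z. norm (z - \<theta>) < d \<longrightarrow>
      norm (?c z - ?c \<theta> - (z - \<theta>) \<bullet> axis i 1) \<le> \<eta> * norm (z - \<theta>)"
    using \<delta>(1) by blast
qed

end

section \<open>The energy and its stationary points\<close>

text \<open>The loss contributes \<open>q \<bullet> pattern_mean X\<close> and the expanded square
  its negative, so the linear terms cancel, as do the squared norms of the mean.\<close>

lemma hfy_energy_eq:
  fixes X :: "real ^ 'd ^ 'n"
  assumes "\<beta> > 0"
  shows "hfy_energy X \<beta> \<Omega> q
    = q \<bullet> q / 2 - real_of_ereal (conjugate \<Omega> (\<beta> *\<^sub>R (X *v q))) / \<beta>
      + (1 / 2 * (max_norm X)\<^sup>2 - real_of_ereal (\<Omega> uniform) / \<beta>)"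
proof -
  have linear: "(X *v q) \<bullet> uniform = q \<bullet> pattern_mean X"
    by (simp only: pattern_mean_def inner_matrix_transpose)
  have square: "(norm (q - pattern_mean X))\<^sup>2
      = q \<bullet> q - 2 * (q \<bullet> pattern_mean X) + (norm (pattern_mean X))\<^sup>2"
    by (simp add: power2_norm_eq_inner inner_diff_left inner_diff_right inner_commute)
  show ?thesis
    using assms unfolding hfy_energy_def loss_eq[OF uniform_in_prob_simplex] square
    by (simp add: linear add_divide_distrib diff_divide_distrib algebra_simps)
qed

end

end

lemma mult_row_nth_diff:
  fixes X :: "real ^ 'd ^ 'n"
  shows "(\<beta> *\<^sub>R (X *v q)) $ i - (\<beta> *\<^sub>R (X *v q)) $ j = \<beta> * (q \<bullet> (row i X - row j X))"
  by (simp add: matrix_vector_mul_component row_def vec_nth_inverse inner_diff_right inner_commute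
      right_diff_distrib)

text \<open>In the second conjunct the condition on \<open>q0\<close> yields the first step. Staying
  at \<open>row i X\<close> means that it is a fixed point of the update, which is what the
  condition on \<open>separation\<close> expresses.\<close>

theorem proposition2:
  fixes X :: "real ^ 'd ^ 'n" and \<beta> m :: real and \<Omega> :: "real ^ 'n \<Rightarrow> ereal" and i :: 'n
  assumes "\<beta> > 0"
    and "generalized_negentropy \<Omega>"
    and "maximum_attained \<Omega>"
    and "is_margin (fenchel_young_loss \<Omega>) m"
    and "row i X \<notin> convex hull ((\<lambda>j. row j X) ` (-{i}))"
  shows "(stationary_point (hfy_energy X \<beta> \<Omega>) (row i X) \<longleftrightarrow> separation X i \<ge> ereal (m / \<beta>))
    \<and> (\<forall>q0. (\<forall>j. j \<noteq> i \<longrightarrow> q0 \<bullet> (row i X - row j X) \<ge> m / \<beta>) \<longrightarrow>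
          hfy_update X \<beta> \<Omega> q0 = row i X \<and>
          (separation X i \<ge> ereal (m / \<beta>) \<longrightarrow>
            (\<forall>t\<ge>1. (hfy_update X \<beta> \<Omega> ^^ t) q0 = row i X)))
    \<and> (\<forall>\<epsilon>::real. (\<forall>k. norm (row k X) = max_norm X) \<longrightarrow>
          separation X i \<ge> ereal (m / \<beta> + 2 * max_norm X * \<epsilon>) \<longrightarrow>
          (\<forall>q0. norm (q0 - row i X) \<le> \<epsilon> \<longrightarrow>
            (\<forall>t\<ge>1. (hfy_update X \<beta> \<Omega> ^^ t) q0 = row i X)))"
proof -
  have cond: "margin_condition (fenchel_young_loss \<Omega>) m"
    using assms(4) by (simp add: is_margin_def)
  note predict_iff = prediction_eq_axis_iff[OF assms(2,3) cond]
  have gap_iff: "(m \<le> (\<beta> *\<^sub>R (X *v q)) $ i - (\<beta> *\<^sub>R (X *v q)) $ j)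
      \<longleftrightarrow> m / \<beta> \<le> q \<bullet> (row i X - row j X)" for q j
    unfolding mult_row_nth_diff using assms(1) by (simp add: field_simps)
  have update: "hfy_update X \<beta> \<Omega> q = row i X"
    if "\<forall>j. j \<noteq> i \<longrightarrow> m / \<beta> \<le> q \<bullet> (row i X - row j X)" for q
  proof -
    have "prediction \<Omega> (\<beta> *\<^sub>R (X *v q)) = axis i 1"
      unfolding predict_iff gap_iff using that .
    then show ?thesis
      by (simp only: hfy_update_def transpose_mult_axis)
  qed
  have iterate: "(hfy_update X \<beta> \<Omega> ^^ t) q = row i X"
    if "\<forall>j. j \<noteq> i \<longrightarrow> m / \<beta> \<le> q \<bullet> (row i X - row j X)" "separation X i \<ge> ereal (m / \<beta>)" "t \<ge> 1"
    for q t
    using \<open>t \<ge> 1\<close>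
  proof (induction t rule: dec_induct)
    case base
    then show ?case
      using update[OF that(1)] by simp
  next
    \<comment> \<open>From the first step on the query is \<open>row i X\<close>, which satisfies
      the query condition by separation.\<close>
    case (step t)
    then show ?case
      using update[of "row i X"] that(2) by (simp add: separation_ge_iff)
  qed
  let ?c = "\<lambda>\<theta>. real_of_ereal (conjugate \<Omega> \<theta>)"
  let ?L = "\<lambda>q. \<beta> *\<^sub>R (X *v q)"
  have L: "(?L has_derivative ?L) (at q)" for q
    by (intro bounded_linear.has_derivative[of ?L] bounded_linear_intros) auto
  have L_inner: "?L h \<bullet> y = \<beta> * (h \<bullet> (transpose X *v y))" for h y
    by (simp only: inner_scaleR_left inner_matrix_transpose)
  define K where "K = 1 / 2 * (max_norm X)\<^sup>2 - real_of_ereal (\<Omega> uniform) / \<beta>"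
  have E: "hfy_energy X \<beta> \<Omega> = (\<lambda>q. q \<bullet> q / 2 - ?c (?L q) / \<beta> + K)"
    unfolding K_def by (rule ext, rule hfy_energy_eq[OF assms(2,3,1)])
  have stationary: "stationary_point (hfy_energy X \<beta> \<Omega>) (row i X)"
    if sep: "separation X i \<ge> ereal (m / \<beta>)"
  proof -
    have "GDERIV ?c (?L (row i X)) :> axis i 1"
      using sep[unfolded separation_ge_iff]
      by (intro conjugate_gderiv[OF assms(2,3) cond], unfold gap_iff) blast
    then have "((\<lambda>q. ?c (?L q)) has_derivative (\<lambda>h. ?L h \<bullet> axis i 1)) (at (row i X))"
      unfolding gderiv_def by (rule has_derivative_compose[OF L])
    then have c: "((\<lambda>q. ?c (?L q)) has_derivative (\<lambda>h. \<beta> * (h \<bullet> row i X))) (at (row i X))"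
      by (simp only: L_inner transpose_mult_axis)
    \<comment> \<open>The quadratic part has derivative \<open>h \<bullet> row i X\<close>, and the
      conjugate part, after the factor \<open>1 / \<beta>\<close>, the same; they cancel.\<close>
    from has_derivative_add[OF has_derivative_diff[OF has_derivative_half_inner_self
        has_derivative_mult_right[OF c, of "1 / \<beta>"]] has_derivative_const[of K]]
    show ?thesis
      using assms(1) by (simp add: E stationary_point_def gderiv_def)
  qed
  have separated: "separation X i \<ge> ereal (m / \<beta>)"
    if stat: "stationary_point (hfy_energy X \<beta> \<Omega>) (row i X)"
  proof -
    let ?y = "prediction \<Omega> (?L (row i X))"
    let ?v = "transpose X *v ?y"
    \<comment> \<open>Up to a constant \<open>G\<close> is
      \<open>?c (?L q) / \<beta> - q \<bullet> ?v\<close>, which the subgradient inequality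
      minimizes at \<open>row i X\<close>. Written through the energy, it inherits differentiability
      there from stationarity.\<close>
    define G where "G q = q \<bullet> q / 2 - hfy_energy X \<beta> \<Omega> q - q \<bullet> ?v" for q
    have "(hfy_energy X \<beta> \<Omega> has_derivative (\<lambda>h. 0)) (at (row i X))"
      using stat by (simp add: stationary_point_def gderiv_def)
    from has_derivative_diff[OF has_derivative_diff[OF has_derivative_half_inner_self this]
        has_derivative_inner_left[OF has_derivative_ident]]
    have "(G has_derivative (\<lambda>h. h \<bullet> (row i X - ?v))) (at (row i X))"
      by (simp add: G_def[abs_def] inner_diff_right)
    moreover have "G (row i X) \<le> G q" for q
    proof -
      have "?c (?L (row i X)) + (?L q - ?L (row i X)) \<bullet> ?y \<le> ?c (?L q)"
        by (rule conjugate_subgradient[OF assms(2,3)])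
      then have "?c (?L (row i X)) + \<beta> * (q \<bullet> ?v) - \<beta> * (row i X \<bullet> ?v) \<le> ?c (?L q)"
        unfolding inner_diff_left L_inner by simp
      then have "q \<bullet> ?v - row i X \<bullet> ?v \<le> (?c (?L q) - ?c (?L (row i X))) / \<beta>"
        unfolding pos_le_divide_eq[OF assms(1)] by (simp add: algebra_simps)
      then show ?thesis
        unfolding G_def E by (simp add: diff_divide_distrib)
    qed
    ultimately have "(\<lambda>h. h \<bullet> (row i X - ?v)) = (\<lambda>h. 0)"
      by (intro has_derivative_local_min[of G _ "row i X"]) auto
    \<comment> \<open>The vanishing derivative is evaluated at
      \<open>h = row i X - ?v\<close>.\<close>
    then have "(row i X - ?v) \<bullet> (row i X - ?v) = 0"
      by (rule fun_cong)
    then have "?v = row i X"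
      by simp
    then have "?y = axis i 1"
      using prediction_maximizes(1)[OF assms(2,3)] assms(5) by (intro eq_axis_of_notin_hull)
    then show ?thesis
      unfolding predict_iff gap_iff separation_ge_iff .
  qed
  have close: "(hfy_update X \<beta> \<Omega> ^^ t) q0 = row i X"
    if norm: "\<forall>k. norm (row k X) = max_norm X"
      and sep: "separation X i \<ge> ereal (m / \<beta> + 2 * max_norm X * \<epsilon>)"
      and q0: "norm (q0 - row i X) \<le> \<epsilon>" and "t \<ge> 1"
    for \<epsilon> q0 t
  proof (rule iterate[OF _ _ \<open>t \<ge> 1\<close>])
    \<comment> \<open>The closeness of \<open>q0\<close> forces \<open>\<epsilon> \<ge> 0\<close>,
      so the assumed separation exceeds \<open>m / \<beta>\<close> by a nonnegative amount.\<close>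
    have "0 \<le> \<epsilon> * max_norm X"
      using norm norm_ge_zero[of "row i X"] order_trans[OF norm_ge_zero q0] by simp
    then show "separation X i \<ge> ereal (m / \<beta>)"
      using sep by (intro order_trans[OF _ sep]) simp
    show "\<forall>j. j \<noteq> i \<longrightarrow> m / \<beta> \<le> q0 \<bullet> (row i X - row j X)"
    proof (intro allI impI)
      fix j assume "j \<noteq> i"
      let ?d = "row i X - row j X"
      \<comment> \<open>By Cauchy-Schwarz, replacing \<open>row i X\<close> by \<open>q0\<close>
        changes the inner product with \<open>?d\<close> by at most
        \<open>2 * max_norm X * \<epsilon>\<close>, the excess in the separation.\<close>
      have "norm ?d \<le> 2 * max_norm X"
        using norm_triangle_ineq4[of "row i X" "row j X"] norm by simp
      then have "norm (q0 - row i X) * norm ?d \<le> \<epsilon> * (2 * max_norm X)"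
        using q0 order_trans[OF norm_ge_zero q0] by (intro mult_mono) auto
      then have "- (2 * max_norm X * \<epsilon>) \<le> (q0 - row i X) \<bullet> ?d"
        using Cauchy_Schwarz_ineq2[of "q0 - row i X" ?d] by (simp add: mult.commute abs_le_iff)
      moreover have "m / \<beta> + 2 * max_norm X * \<epsilon> \<le> row i X \<bullet> ?d"
        using sep \<open>j \<noteq> i\<close> unfolding separation_ge_iff by blast
      ultimately show "m / \<beta> \<le> q0 \<bullet> ?d"
        by (simp add: inner_diff_left)
    qed
  qed
  show ?thesis
    by (intro conjI allI impI iffI;
        (rule stationary separated update iterate close; assumption))
qed

end
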